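(* Let $(A,m_A)$ be an equicharacteristic regular local ring of dimension $n$, and let $\nu$ be a rank 1 valuation of the quotient field of $A$ which dominates $A$. Let $s_0=\min\{\nu(f)\mid f\in m_A\}$. Then $$ |\nu(m_A-\{0\})\cap[0,(d+1)s_0)|<\binom{n+d}{n} $$ for all $d\in\mathbb{N}$.
   Context: $|T|$ denotes the cardinality of a set $T$. A local domain is equicharacteristic if it has the same characteristic as its residue field. A valuation $\nu$ of the quotient field of $A$, with valuation ring $V$ and maximal ideal $m_V$, dominates $A$ if $A\subset V$ and $m_V\cap A=m_A$. The convention $\nu(0)=\infty$ is used, so $s_0$ is the minimum of the values of nonzero elements of $m_A$. The value group $\Gamma$ of $\nu$ is a totally ordered abelian group, written additively; rank 1 means that $\Gamma$ is nonzero and order isomorphic to a subgroup of $\mathbb{R}$. For $a,b\in\Gamma$, $[a,b)=\{c\in\Gamma\mid a\le c<b\}$. *)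

theory Defs
  imports Complex_Main "HOL-Library.Extended_Nat" "HOL-Algebra.Algebra"
begin

section \<open>Regular local rings\<close>

text \<open>The Krull dimension: the supremum of all \<open>r\<close> such that there is a chain
  \<open>P\<^sub>0 \<subset> P\<^sub>1 \<subset> \<dots> \<subset> P\<^sub>r\<close> of prime ideals.\<close>

definition krull_dim :: "('a, 'b) ring_scheme \<Rightarrow> enat" where
  "krull_dim R = Sup {enat (length Ps - 1) | Ps.
     Ps \<noteq> [] \<and> (\<forall>P \<in> set Ps. primeideal P R) \<and> sorted_wrt (\<subset>) Ps}"

definition local_ring :: "('a, 'b) ring_scheme \<Rightarrow> 'a set \<Rightarrow> bool" where
  "local_ring R \<mm> \<longleftrightarrow> cring R \<and> {I. maximalideal I R} = {\<mm>}"

text \<open>This is only meaningful for finitely generated ideals; it is used for Noetherian rings.\<close>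

definition min_generators :: "('a, 'b) ring_scheme \<Rightarrow> 'a set \<Rightarrow> nat" where
  "min_generators R I =
     (LEAST k. \<exists>S \<subseteq> carrier R. finite S \<and> card S = k \<and> Idl\<^bsub>R\<^esub> S = I)"

definition regular_local_ring :: "('a, 'b) ring_scheme \<Rightarrow> 'a set \<Rightarrow> bool" where
  "regular_local_ring R \<mm> \<longleftrightarrow>
     noetherian_ring R \<and> local_ring R \<mm> \<and> krull_dim R = enat (min_generators R \<mm>)"

text \<open>The characteristic is the order of \<open>1\<close> in the additive group;
  \<^const>\<open>group.ord\<close> is \<open>0\<close> for elements of infinite order.\<close>

definition characteristic :: "('a, 'b) ring_scheme \<Rightarrow> nat" where
  "characteristic R = group.ord (add_monoid R) \<one>\<^bsub>R\<^esub>"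

definition equicharacteristic :: "('a, 'b) ring_scheme \<Rightarrow> 'a set \<Rightarrow> bool" where
  "equicharacteristic R \<mm> \<longleftrightarrow> characteristic R = characteristic (R Quot \<mm>)"

definition quotient_field_of :: "('a, 'b) ring_scheme \<Rightarrow> 'a set \<Rightarrow> bool" where
  "quotient_field_of K A \<longleftrightarrow> field K \<and> subring A K \<and>
     (\<forall>x \<in> carrier K. \<exists>a \<in> A. \<exists>b \<in> A - {\<zero>\<^bsub>K\<^esub>}. x = a \<otimes>\<^bsub>K\<^esub> inv\<^bsub>K\<^esub> b)"

section \<open>Valuations\<close>

text \<open>The convention \<open>\<nu>(0) = \<infinity>\<close> is rendered by never using the value of \<open>\<nu>\<close> at \<open>0\<close>:
  all definitions below treat \<open>0\<close> separately. The map \<open>\<nu>\<close> need not be onto the ordered group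
  \<open>'g\<close>; the value group is its image on the nonzero elements.\<close>

definition valuation ::
    "('a, 'b) ring_scheme \<Rightarrow> ('a \<Rightarrow> 'g::linordered_ab_group_add) \<Rightarrow> bool" where
  "valuation K \<nu> \<longleftrightarrow>
     (\<forall>x \<in> carrier K - {\<zero>\<^bsub>K\<^esub>}. \<forall>y \<in> carrier K - {\<zero>\<^bsub>K\<^esub>}.
        \<nu> (x \<otimes>\<^bsub>K\<^esub> y) = \<nu> x + \<nu> y \<and>
        (x \<oplus>\<^bsub>K\<^esub> y \<noteq> \<zero>\<^bsub>K\<^esub> \<longrightarrow> min (\<nu> x) (\<nu> y) \<le> \<nu> (x \<oplus>\<^bsub>K\<^esub> y)))"

definition value_group ::
    "('a, 'b) ring_scheme \<Rightarrow> ('a \<Rightarrow> 'g::linordered_ab_group_add) \<Rightarrow> 'g set" where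
  "value_group K \<nu> = \<nu> ` (carrier K - {\<zero>\<^bsub>K\<^esub>})"

definition valuation_ring ::
    "('a, 'b) ring_scheme \<Rightarrow> ('a \<Rightarrow> 'g::linordered_ab_group_add) \<Rightarrow> 'a set" where
  "valuation_ring K \<nu> = {x \<in> carrier K. x = \<zero>\<^bsub>K\<^esub> \<or> 0 \<le> \<nu> x}"

definition valuation_ideal ::
    "('a, 'b) ring_scheme \<Rightarrow> ('a \<Rightarrow> 'g::linordered_ab_group_add) \<Rightarrow> 'a set" where
  "valuation_ideal K \<nu> = {x \<in> carrier K. x = \<zero>\<^bsub>K\<^esub> \<or> 0 < \<nu> x}"

definition dominates ::
    "('a, 'b) ring_scheme \<Rightarrow> ('a \<Rightarrow> 'g::linordered_ab_group_add) \<Rightarrow> 'a set \<Rightarrow> 'a set \<Rightarrow> bool" where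
  "dominates K \<nu> A \<mm> \<longleftrightarrow> A \<subseteq> valuation_ring K \<nu> \<and> valuation_ideal K \<nu> \<inter> A = \<mm>"

text \<open>The value group is nonzero and isomorphic, as an ordered group, to a subgroup of the reals
  (the image of \<open>\<phi>\<close>).\<close>

definition rank_one ::
    "('a, 'b) ring_scheme \<Rightarrow> ('a \<Rightarrow> 'g::linordered_ab_group_add) \<Rightarrow> bool" where
  "rank_one K \<nu> \<longleftrightarrow> value_group K \<nu> \<noteq> {0} \<and>
     (\<exists>\<phi> :: 'g \<Rightarrow> real. strict_mono_on (value_group K \<nu>) \<phi> \<and>
        (\<forall>a \<in> value_group K \<nu>. \<forall>b \<in> value_group K \<nu>. \<phi> (a + b) = \<phi> a + \<phi> b))"

text \<open>\<open>nat_mult k s = k s\<close> in an additive group without a ring structure.\<close>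

definition nat_mult :: "nat \<Rightarrow> 'g::comm_monoid_add \<Rightarrow> 'g" where
  "nat_mult k s = (\<Sum>_<k. s)"

text \<open>The half-open interval \<open>[a, b)\<close> in the value group.\<close>

definition value_interval ::
    "('a, 'b) ring_scheme \<Rightarrow> ('a \<Rightarrow> 'g::linordered_ab_group_add) \<Rightarrow> 'g \<Rightarrow> 'g \<Rightarrow> 'g set" where
  "value_interval K \<nu> a b = {c \<in> value_group K \<nu>. a \<le> c \<and> c < b}"

text \<open>The minimum of \<open>\<nu>\<close> on an ideal, where \<open>\<nu>(0) = \<infinity>\<close>.\<close>

definition min_value ::
    "('a, 'b) ring_scheme \<Rightarrow> ('a \<Rightarrow> 'g::linordered_ab_group_add) \<Rightarrow> 'a set \<Rightarrow> 'g" where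
  "min_value K \<nu> \<mm> = (LEAST s. s \<in> \<nu> ` (\<mm> - {\<zero>\<^bsub>K\<^esub>}))"

end

theory Submission
  imports Defs
begin

text \<open>By regularity \<open>\<mm>\<close> is generated by \<open>n\<close> elements. Let \<open>I\<^sub>i = \<mm>\<^sup>i\<close>, the ideal generated by the monomials
  of degree \<open>i\<close> in the generators. Nonzero elements of \<open>I\<^bsub>d+1\<^esub>\<close> have value at least
  \<open>(d + 1) s\<^sub>0\<close>, so the values below \<open>(d + 1) s\<^sub>0\<close> are among those lost on passing from \<open>A\<close> to \<open>I\<^bsub>d+1\<^esub>\<close>.
  This passage can be made by dropping one monomial \<open>t\<close> of degree at most \<open>d\<close> at a time, and every
  step has the form \<open>I + A t \<supseteq> I\<close> with \<open>\<mm> t \<subseteq> I\<close>. The quotient \<open>(I + A t) / I\<close> has length at most one;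
  in terms of values this says that a step loses at most one value
  (\<open>cyclic_extension_value_unique\<close>). Hence at most as many values are lost as there are
  monomials of degree at most \<open>d\<close> in \<open>n\<close> variables, namely \<open>(n + d) choose n\<close>. One of the lost
  values is \<open>0 = \<nu>(1)\<close>, which is not a value on \<open>\<mm>\<close>: this makes the inequality strict.

  The step from \<open>I + A t\<close> to \<open>I\<close> works directly with elements. If \<open>f\<close> and \<open>g\<close> are congruent to
  \<open>a t\<close> and \<open>b t\<close> modulo \<open>I\<close>, then \<open>b f - a g\<close> lies in \<open>I\<close>; and if \<open>g\<close> is not in \<open>I\<close>, then \<open>b\<close>
  has value \<open>0\<close>, so that \<open>\<nu>(f) < \<nu>(g)\<close> would make \<open>\<nu>(f)\<close> the value of this element of \<open>I\<close>.\<close>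

lemma card_Diff_trans:
  assumes "finite (U - V)" "card (U - V) \<le> k" "finite (V - W)" "card (V - W) \<le> l"
  shows "finite (U - W) \<and> card (U - W) \<le> k + l"
proof -
  have sub: "U - W \<subseteq> (U - V) \<union> (V - W)" by auto
  have "card (U - W) \<le> card ((U - V) \<union> (V - W))" using sub assms by (intro card_mono) auto
  also have "\<dots> \<le> card (U - V) + card (V - W)" by (rule card_Un_le)
  finally show ?thesis using assms sub by (auto intro: finite_subset)
qed

section \<open>Domains with a nonnegative valuation\<close>

text \<open>The counting takes place in the local ring alone, with the valuation restricted to it. Its
  maximal ideal is then the center of the valuation, the set of elements of positive value.\<close>

locale nonneg_valued_domain = domain R for R (structure) +
  fixes \<nu> :: "'a \<Rightarrow> 'g::linordered_ab_group_add"
  assumes valuation: "valuation R \<nu>"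
    and nonneg: "\<lbrakk>x \<in> carrier R; x \<noteq> \<zero>\<rbrakk> \<Longrightarrow> 0 \<le> \<nu> x"
begin

abbreviation center :: "'a set" where
  "center \<equiv> valuation_ideal R \<nu>"

definition value_set :: "'a set \<Rightarrow> 'g set" where
  "value_set I = \<nu> ` (I - {\<zero>})"

text \<open>The element \<open>\<zero>\<close> belongs to it for every \<open>\<gamma>\<close>: its value counts as \<open>\<infinity>\<close>.\<close>

definition value_ideal :: "'g \<Rightarrow> 'a set" where
  "value_ideal \<gamma> = {x \<in> carrier R. x = \<zero> \<or> \<gamma> \<le> \<nu> x}"

lemma value_mult:
  assumes "x \<in> carrier R" "y \<in> carrier R" "x \<noteq> \<zero>" "y \<noteq> \<zero>"
  shows "\<nu> (x \<otimes> y) = \<nu> x + \<nu> y"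
  using valuation assms unfolding valuation_def by blast

lemma value_add:
  assumes "x \<in> carrier R" "y \<in> carrier R" "x \<noteq> \<zero>" "y \<noteq> \<zero>" "x \<oplus> y \<noteq> \<zero>"
  shows "min (\<nu> x) (\<nu> y) \<le> \<nu> (x \<oplus> y)"
  using valuation assms unfolding valuation_def by blast

lemma value_one: "\<nu> \<one> = 0"
  using value_mult[of \<one> \<one>] by simp

lemma value_mult_ge:
  assumes "x \<in> carrier R" "y \<in> carrier R" "x \<otimes> y \<noteq> \<zero>"
  shows "\<nu> y \<le> \<nu> (x \<otimes> y)"
proof -
  have "x \<noteq> \<zero>" "y \<noteq> \<zero>" using assms by auto
  then show ?thesis using value_mult nonneg assms by simp
qed

text \<open>Closure under multiplication by ring elements uses that these have nonnegative value; it
  also gives closure under negation, as multiplication by \<open>\<ominus> \<one>\<close>.\<close>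

lemma value_ideal_is_ideal: "ideal (value_ideal \<gamma>) R"
proof (rule idealI)
  have mult: "x \<otimes> a \<in> value_ideal \<gamma>" if "a \<in> value_ideal \<gamma>" "x \<in> carrier R" for a x
    using that value_mult_ge[of x a] unfolding value_ideal_def by force
  then show "x \<otimes> a \<in> value_ideal \<gamma>" if "a \<in> value_ideal \<gamma>" "x \<in> carrier R" for a x
    using that .
  show "a \<otimes> x \<in> value_ideal \<gamma>" if "a \<in> value_ideal \<gamma>" "x \<in> carrier R" for a x
    using that mult[of a x] m_comm[of a x] unfolding value_ideal_def by auto
  show "subgroup (value_ideal \<gamma>) (add_monoid R)"
  proof (rule add.subgroupI)
    show "value_ideal \<gamma> \<subseteq> carrier R" "value_ideal \<gamma> \<noteq> {}"
      unfolding value_ideal_def by auto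
    show "\<ominus> a \<in> value_ideal \<gamma>" if "a \<in> value_ideal \<gamma>" for a
      using mult[OF that, of "\<ominus> \<one>"] that l_minus[of \<one> a] unfolding value_ideal_def by auto
    show "a \<oplus> b \<in> value_ideal \<gamma>" if "a \<in> value_ideal \<gamma>" "b \<in> value_ideal \<gamma>" for a b
    proof (cases "a = \<zero> \<or> b = \<zero> \<or> a \<oplus> b = \<zero>")
      case True
      then show ?thesis using that unfolding value_ideal_def by auto
    next
      case False
      then have "min (\<nu> a) (\<nu> b) \<le> \<nu> (a \<oplus> b)"
        using that value_add unfolding value_ideal_def by auto
      moreover have "\<gamma> \<le> min (\<nu> a) (\<nu> b)"
        using False that unfolding value_ideal_def by auto
      ultimately have "\<gamma> \<le> \<nu> (a \<oplus> b)" by (rule order_trans[rotated])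
      then show ?thesis
        using that unfolding value_ideal_def by auto
    qed
  qed
qed (rule ring_axioms)

lemma value_ideal_ge:
  assumes "f \<in> value_ideal \<gamma>" "f \<noteq> \<zero>"
  shows "\<gamma> \<le> \<nu> f"
  using assms unfolding value_ideal_def by blast

text \<open>An element whose value exceeds that of \<open>u\<close> may be subtracted without changing \<open>\<nu> u\<close>; the
  case \<open>v = \<zero>\<close> is the one of value \<open>\<infinity>\<close>.\<close>

lemma value_minus_dominant:
  assumes u: "u \<in> carrier R" "u \<noteq> \<zero>" and v: "v \<in> carrier R" "v = \<zero> \<or> \<nu> u < \<nu> v"
  shows "u \<ominus> v \<noteq> \<zero>" "\<nu> (u \<ominus> v) = \<nu> u"
proof -
  show nz: "u \<ominus> v \<noteq> \<zero>"
  proof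
    assume "u \<ominus> v = \<zero>"
    then have "u = v" using u v by (simp add: r_right_minus_eq)
    then show False using u v by auto
  qed
  interpret U: ideal "value_ideal (\<nu> u)" R by (rule value_ideal_is_ideal)
  have "u \<in> value_ideal (\<nu> u)" "v \<in> value_ideal (\<nu> u)"
    using u v unfolding value_ideal_def by auto
  then have "u \<ominus> v \<in> value_ideal (\<nu> u)"
    by (simp add: a_minus_def)
  then have ge: "\<nu> u \<le> \<nu> (u \<ominus> v)" using nz value_ideal_ge by blast
  have "\<not> \<nu> u < \<nu> (u \<ominus> v)"
  proof
    assume less: "\<nu> u < \<nu> (u \<ominus> v)"
    have u_eq: "(u \<ominus> v) \<oplus> v = u"
      using u v by (simp add: a_minus_def a_assoc l_neg)
    show False
    proof (cases "v = \<zero>")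
      case True
      then show False using less u_eq u by simp
    next
      case False
      then have "min (\<nu> (u \<ominus> v)) (\<nu> v) \<le> \<nu> u"
        using value_add[of "u \<ominus> v" v] nz u v u_eq by simp
      then show False using less v False by (auto simp: min_le_iff_disj)
    qed
  qed
  then show "\<nu> (u \<ominus> v) = \<nu> u" using ge by simp
qed

section \<open>The values lost along a chain of ideals\<close>

text \<open>Here \<open>\<gamma>\<close> and \<open>\<delta>\<close> are the values of \<open>f \<equiv> a t\<close> and \<open>g \<equiv> b t\<close> modulo \<open>I\<close>, and \<open>b\<close> is outside
  the center since \<open>g\<close> is not in \<open>I\<close>.\<close>

lemma cyclic_extension_value_not_less:
  assumes I: "ideal I R" and t: "t \<in> carrier R" "\<And>a. a \<in> center \<Longrightarrow> a \<otimes> t \<in> I"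
    and \<gamma>: "\<gamma> \<in> value_set (I <+> PIdl t) - value_set I"
    and \<delta>: "\<delta> \<in> value_set (I <+> PIdl t) - value_set I"
  shows "\<not> \<gamma> < \<delta>"
proof
  assume less: "\<gamma> < \<delta>"
  interpret I: ideal I R by (rule I)
  have rep: "\<exists>i a. i \<in> I \<and> a \<in> carrier R \<and> f = i \<oplus> a \<otimes> t" if "f \<in> I <+> PIdl t" for f :: 'a
    using that unfolding set_add_def' cgenideal_def by auto
  obtain f :: 'a where f: "f \<in> I <+> PIdl t" "f \<noteq> \<zero>" "\<gamma> = \<nu> f"
    using \<gamma> unfolding value_set_def by auto
  obtain g :: 'a where g: "g \<in> I <+> PIdl t" "g \<noteq> \<zero>" "\<delta> = \<nu> g"
    using \<delta> unfolding value_set_def by auto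
  obtain i a where ia: "i \<in> I" "a \<in> carrier R" "f = i \<oplus> a \<otimes> t" using rep f by blast
  obtain j b where jb: "j \<in> I" "b \<in> carrier R" "g = j \<oplus> b \<otimes> t" using rep g by blast
  have ij: "i \<in> carrier R" "j \<in> carrier R" using ia jb I.Icarr by auto
  have fg: "f \<in> carrier R" "g \<in> carrier R" using ia jb ij t by auto
  have "g \<notin> I" using \<delta> g unfolding value_set_def by auto
  then have "b \<notin> center" using t(2) jb I.a_closed by auto
  then have b: "b \<noteq> \<zero>" "\<nu> b = 0"
    using jb nonneg[of b] unfolding valuation_ideal_def by auto
  have bf: "b \<otimes> f \<noteq> \<zero>" "\<nu> (b \<otimes> f) = \<gamma>"
    using b f fg jb value_mult[of b f] integral[of b f] by auto
  have ag: "a \<otimes> g = \<zero> \<or> \<nu> (b \<otimes> f) < \<nu> (a \<otimes> g)"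
    using value_mult_ge[OF ia(2) fg(2)] g(3) bf(2) less less_le_trans by metis
  have cancel: "(p \<oplus> r) \<ominus> (q \<oplus> r) = p \<ominus> q"
    if "p \<in> carrier R" "q \<in> carrier R" "r \<in> carrier R" for p q r
    using that by algebra
  have "b \<otimes> f \<ominus> a \<otimes> g = b \<otimes> i \<ominus> a \<otimes> j"
    using cancel[of "b \<otimes> i" "a \<otimes> j" "b \<otimes> (a \<otimes> t)"] ia(2) jb(2) ij t(1)
    by (simp add: ia(3) jb(3) r_distr m_lcomm[of a b t])
  moreover have "b \<otimes> i \<ominus> a \<otimes> j \<in> I"
    using ia jb by (simp add: a_minus_def I.I_l_closed)
  ultimately have "b \<otimes> f \<ominus> a \<otimes> g \<in> I - {\<zero>}" "\<nu> (b \<otimes> f \<ominus> a \<otimes> g) = \<gamma>"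
    using value_minus_dominant[of "b \<otimes> f" "a \<otimes> g"] bf ag ia jb fg by auto
  then have "\<gamma> \<in> value_set I" unfolding value_set_def by force
  then show False using \<gamma> by simp
qed

lemma cyclic_extension_value_unique:
  assumes "ideal I R" "t \<in> carrier R" "\<And>a. a \<in> center \<Longrightarrow> a \<otimes> t \<in> I"
  shows "finite (value_set (I <+> PIdl t) - value_set I) \<and>
    card (value_set (I <+> PIdl t) - value_set I) \<le> 1"
proof -
  have "\<gamma> = \<delta>" if "\<gamma> \<in> value_set (I <+> PIdl t) - value_set I"
    "\<delta> \<in> value_set (I <+> PIdl t) - value_set I" for \<gamma> \<delta>
    using cyclic_extension_value_not_less[OF assms] that by (meson linorder_neqE)
  then obtain \<gamma> where sub: "value_set (I <+> PIdl t) - value_set I \<subseteq> {\<gamma>}" by blast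
  show ?thesis
    using card_mono[OF _ sub] finite_subset[OF sub] by simp
qed

lemma value_set_mono: "I \<subseteq> J \<Longrightarrow> value_set I \<subseteq> value_set J"
  unfolding value_set_def by auto

text \<open>Adding the elements of \<open>T\<close> to \<open>I\<close> one by one, each addition is a cyclic extension of the kind
  above: the condition that the center multiplies \<open>T\<close> into \<open>I\<close> persists when \<open>I\<close> grows.\<close>

lemma card_values_lost_le:
  assumes I: "ideal I R" and T: "finite T" "T \<subseteq> carrier R"
    and ann: "\<And>a t. \<lbrakk>a \<in> center; t \<in> T\<rbrakk> \<Longrightarrow> a \<otimes> t \<in> I"
  shows "finite (value_set (Idl (I \<union> T)) - value_set I) \<and>
    card (value_set (Idl (I \<union> T)) - value_set I) \<le> card T"
  using T ann
proof (induction T rule: finite_induct)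
  case empty
  have "Idl I \<subseteq> I" using I by (rule genideal_minimal) simp
  then have lost: "value_set (Idl (I \<union> {})) - value_set I = {}"
    using value_set_mono[of "Idl I" I] by simp
  show ?case unfolding lost by simp
next
  case (insert t T)
  let ?J = "Idl (I \<union> T)"
  have carr: "I \<union> T \<subseteq> carrier R" "t \<in> carrier R"
    using insert.prems(1) ideal.Icarr[OF I] by auto
  have J: "ideal ?J R" "I \<union> T \<subseteq> ?J"
    by (rule genideal_ideal[OF carr(1)], rule genideal_self[OF carr(1)])
  have P: "ideal (PIdl t) R" "t \<in> PIdl t"
    using carr cgenideal_ideal cgenideal_self by auto
  have in_sum: "x \<oplus> y \<in> ?J <+> PIdl t" if "x \<in> ?J" "y \<in> PIdl t" for x y
    using that unfolding set_add_def' by auto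
  have zeros: "\<zero> \<in> ?J" "\<zero> \<in> PIdl t"
    using J(1) P(1) by (simp_all add: additive_subgroup.zero_closed ideal.axioms(1))
  have "I \<union> insert t T \<subseteq> ?J <+> PIdl t"
  proof
    fix x assume x: "x \<in> I \<union> insert t T"
    show "x \<in> ?J <+> PIdl t"
    proof (cases "x = t")
      case True
      then show ?thesis using in_sum[OF zeros(1) P(2)] carr by simp
    next
      case False
      then have "x \<in> ?J" "x \<in> carrier R" using x J(2) carr(1) by auto
      then show ?thesis using in_sum[OF _ zeros(2), of x] by simp
    qed
  qed
  then have "Idl (I \<union> insert t T) \<subseteq> ?J <+> PIdl t"
    by (rule genideal_minimal[OF add_ideals[OF J(1) P(1)]])
  then have sub: "value_set (Idl (I \<union> insert t T)) - value_set I
      \<subseteq> value_set (?J <+> PIdl t) - value_set I"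
    using value_set_mono by blast
  have step: "finite (value_set (?J <+> PIdl t) - value_set ?J) \<and>
      card (value_set (?J <+> PIdl t) - value_set ?J) \<le> 1"
    using J insert.prems(2) by (intro cyclic_extension_value_unique[OF J(1) carr(2)]) blast
  have "finite (value_set (?J <+> PIdl t) - value_set I) \<and>
      card (value_set (?J <+> PIdl t) - value_set I) \<le> 1 + card T"
    using step insert.IH insert.prems by (intro card_Diff_trans[of _ "value_set ?J"]) auto
  then show ?case
    using card_mono[OF _ sub] finite_subset[OF sub] insert.hyps by auto
qed

section \<open>Monomials in the generators of the center\<close>

primrec monomials :: "'a set \<Rightarrow> nat \<Rightarrow> 'a set" where
  "monomials S 0 = {\<one>}"
| "monomials S (Suc k) = S <#> monomials S k"

lemma monomials_SucI: "\<lbrakk>s \<in> S; t \<in> monomials S k\<rbrakk> \<Longrightarrow> s \<otimes> t \<in> monomials S (Suc k)"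
  unfolding monomials.simps set_mult_def by auto

lemma monomials_SucE:
  assumes "u \<in> monomials S (Suc k)"
  obtains s t where "s \<in> S" "t \<in> monomials S k" "u = s \<otimes> t"
  using assms unfolding monomials.simps set_mult_def by auto

lemma monomials_closed: "S \<subseteq> carrier R \<Longrightarrow> monomials S k \<subseteq> carrier R"
  by (induction k) (auto intro: set_mult_closed[THEN subsetD])

lemma finite_monomials: "finite S \<Longrightarrow> finite (monomials S k)"
  by (induction k) (auto simp: set_mult_def)

declare monomials.simps(2) [simp del]

text \<open>A monomial either involves the variable \<open>x\<close> or does not; this is Pascal's recursion for the
  number of monomials.\<close>

lemma monomials_insert:
  assumes "insert x S \<subseteq> carrier R"
  shows "monomials (insert x S) (Suc k)
    \<subseteq> (\<lambda>t. x \<otimes> t) ` monomials (insert x S) k \<union> monomials S (Suc k)"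
proof (induction k)
  case 0
  then show ?case by (auto simp: monomials.simps(2) set_mult_def)
next
  case (Suc k)
  show ?case
  proof
    fix u assume "u \<in> monomials (insert x S) (Suc (Suc k))"
    then obtain s t where st: "s \<in> insert x S" "t \<in> monomials (insert x S) (Suc k)" "u = s \<otimes> t"
      by (rule monomials_SucE)
    show "u \<in> (\<lambda>t. x \<otimes> t) ` monomials (insert x S) (Suc k) \<union> monomials S (Suc (Suc k))"
    proof (cases "s = x")
      case True
      then show ?thesis using st by blast
    next
      case False
      then have s: "s \<in> S" using st by simp
      from st(2) Suc consider t' where "t' \<in> monomials (insert x S) k" "t = x \<otimes> t'"
        | "t \<in> monomials S (Suc k)" by blast
      then show ?thesis
      proof cases
        case 1
        then have "t' \<in> carrier R" using monomials_closed[OF assms] by blast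
        then have "u = x \<otimes> (s \<otimes> t')"
          using st 1 s assms by (simp add: m_lcomm subset_iff)
        then show ?thesis using monomials_SucI[OF st(1) 1(1)] by blast
      next
        case 2
        then show ?thesis using monomials_SucI[OF s 2] st by simp
      qed
    qed
  qed
qed

text \<open>The right-hand side satisfies Pascal's recursion in \<open>card S\<close> and \<open>d\<close>, and the left-hand side
  satisfies it as an inequality: equality may fail because formally different monomials may be equal
  as ring elements.\<close>

lemma card_monomials_le:
  assumes "finite S" "S \<subseteq> carrier R"
  shows "(\<Sum>i\<le>d. card (monomials S i)) \<le> (card S + d) choose d"
  using assms
proof (induction S arbitrary: d rule: finite_induct)
  case empty
  have "monomials {} (Suc i) = {}" for i by (simp add: monomials.simps(2) set_mult_def)
  then show ?case by (induction d) auto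
next
  case (insert x S)
  let ?T = "insert x S"
  note fin = finite_monomials[OF insert.hyps(1)] finite_monomials[of ?T]
  show ?case
  proof (induction d)
    case 0
    then show ?case by simp
  next
    case (Suc d)
    have step: "card (monomials ?T (Suc i)) \<le> card (monomials ?T i) + card (monomials S (Suc i))"
      for i
    proof -
      have "card (monomials ?T (Suc i))
          \<le> card ((\<lambda>t. x \<otimes> t) ` monomials ?T i \<union> monomials S (Suc i))"
        using monomials_insert[OF insert.prems] fin insert.hyps by (intro card_mono) auto
      also have "\<dots> \<le> card ((\<lambda>t. x \<otimes> t) ` monomials ?T i) + card (monomials S (Suc i))"
        by (rule card_Un_le)
      also have "card ((\<lambda>t. x \<otimes> t) ` monomials ?T i) \<le> card (monomials ?T i)"
        using fin insert.hyps by (intro card_image_le) auto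
      finally show ?thesis by simp
    qed
    have "(\<Sum>i\<le>Suc d. card (monomials ?T i)) = 1 + (\<Sum>i\<le>d. card (monomials ?T (Suc i)))"
      by (subst sum.atMost_Suc_shift) simp
    also have "\<dots> \<le> 1 + (\<Sum>i\<le>d. card (monomials ?T i) + card (monomials S (Suc i)))"
      by (intro add_left_mono sum_mono step)
    also have "\<dots> = (\<Sum>i\<le>d. card (monomials ?T i)) + (\<Sum>i\<le>Suc d. card (monomials S i))"
      by (subst sum.atMost_Suc_shift) (simp add: sum.distrib)
    also have "\<dots> \<le> ((card ?T + d) choose d) + ((card S + Suc d) choose Suc d)"
      using Suc.IH insert.IH[of "Suc d"] insert.prems by (intro add_mono) auto
    also have "\<dots> = (card ?T + Suc d) choose Suc d"
      using insert.hyps by simp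
    finally show ?case .
  qed
qed

lemma center_mult_monomial:
  assumes S: "S \<subseteq> carrier R" "center = Idl S" and a: "a \<in> center" and t: "t \<in> monomials S k"
  shows "a \<otimes> t \<in> Idl (monomials S (Suc k))"
proof -
  let ?I = "Idl (monomials S (Suc k))"
  have tc: "t \<in> carrier R" using monomials_closed[OF S(1)] t by blast
  have M: "monomials S (Suc k) \<subseteq> carrier R" using monomials_closed[OF S(1)] .
  interpret I: ideal ?I R by (rule genideal_ideal[OF M])
  \<comment> \<open>The colon ideal \<open>(?I : t)\<close> contains \<open>S\<close>, hence all of the center.\<close>
  have "ideal {a \<in> carrier R. a \<otimes> t \<in> ?I} R"
  proof (rule idealI)
    show "subgroup {a \<in> carrier R. a \<otimes> t \<in> ?I} (add_monoid R)"
    proof (rule add.subgroupI)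
      show "{a \<in> carrier R. a \<otimes> t \<in> ?I} \<noteq> {}" using tc by (auto intro!: exI[of _ \<zero>] I.zero_closed)
    qed (use tc in \<open>auto simp: l_minus l_distr\<close>)
    show "x \<otimes> a \<in> {a \<in> carrier R. a \<otimes> t \<in> ?I}"
      if "a \<in> {a \<in> carrier R. a \<otimes> t \<in> ?I}" "x \<in> carrier R" for a x
      using that tc by (auto simp: m_assoc I.I_l_closed)
    then show "a \<otimes> x \<in> {a \<in> carrier R. a \<otimes> t \<in> ?I}"
      if "a \<in> {a \<in> carrier R. a \<otimes> t \<in> ?I}" "x \<in> carrier R" for a x
      using that m_comm by force
  qed (rule ring_axioms)
  moreover have "S \<subseteq> {a \<in> carrier R. a \<otimes> t \<in> ?I}"
    using S(1) monomials_SucI[OF _ t] genideal_self[OF M] by blast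
  ultimately have "Idl S \<subseteq> {a \<in> carrier R. a \<otimes> t \<in> ?I}"
    by (rule genideal_minimal)
  then show ?thesis using a S(2) by blast
qed

text \<open>The chain from the whole ring down to the ideal of the monomials of degree \<open>d + 1\<close> passes
  through all lower degrees; in degree \<open>i\<close> the monomials of that degree are dropped.\<close>

lemma card_values_lost_monomials:
  assumes S: "finite S" "S \<subseteq> carrier R" "center = Idl S"
  shows "finite (value_set (carrier R) - value_set (Idl (monomials S (Suc d)))) \<and>
    card (value_set (carrier R) - value_set (Idl (monomials S (Suc d))))
      \<le> (\<Sum>i\<le>d. card (monomials S i))"
proof -
  have step: "finite (value_set (Idl (monomials S k)) - value_set (Idl (monomials S (Suc k)))) \<and>
      card (value_set (Idl (monomials S k)) - value_set (Idl (monomials S (Suc k))))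
        \<le> card (monomials S k)" for k
  proof -
    let ?I = "Idl (monomials S (Suc k))" and ?M = "monomials S k"
    have M: "?M \<subseteq> carrier R" "monomials S (Suc k) \<subseteq> carrier R"
      using monomials_closed[OF S(2)] by auto
    have I: "ideal ?I R" by (rule genideal_ideal[OF M(2)])
    have "?I \<subseteq> carrier R" using ideal.Icarr[OF I] by blast
    then have "Idl ?M \<subseteq> Idl (?I \<union> ?M)"
      using M by (intro subset_Idl_subset) auto
    then have sub: "value_set (Idl ?M) - value_set ?I \<subseteq> value_set (Idl (?I \<union> ?M)) - value_set ?I"
      using value_set_mono by blast
    have "finite (value_set (Idl (?I \<union> ?M)) - value_set ?I) \<and>
        card (value_set (Idl (?I \<union> ?M)) - value_set ?I) \<le> card ?M"
      using card_values_lost_le[OF I finite_monomials[OF S(1)] M(1)]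
        center_mult_monomial[OF S(2,3)] by blast
    then show ?thesis using card_mono[OF _ sub] finite_subset[OF sub] by auto
  qed
  show ?thesis
  proof (induction d)
    case 0
    then show ?case using step[of 0] by (simp add: genideal_one)
  next
    case (Suc d)
    then show ?case
      using card_Diff_trans[OF conjunct1[OF Suc] conjunct2[OF Suc] conjunct1[OF step]
        conjunct2[OF step]] by simp
  qed
qed

section \<open>Counting small values\<close>

text \<open>The order on the values need not be a well-order. The minimum over the center exists because
  the smallest value on a finite set of generators bounds all other values on the center.\<close>

lemma min_value_le:
  assumes S: "finite S" "S \<subseteq> carrier R" "center = Idl S" and "center \<noteq> {\<zero>}"
  shows "0 < min_value R \<nu> center" "\<And>s. \<lbrakk>s \<in> S; s \<noteq> \<zero>\<rbrakk> \<Longrightarrow> min_value R \<nu> center \<le> \<nu> s"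
proof -
  let ?\<gamma> = "Min (\<nu> ` (S - {\<zero>}))"
  have "S - {\<zero>} \<noteq> {}"
  proof
    assume "S - {\<zero>} = {}"
    then have "Idl S \<subseteq> {\<zero>}" using genideal_minimal[OF zeroideal, of S] by auto
    then show False using assms by (auto simp: valuation_ideal_def)
  qed
  then have in_S: "?\<gamma> \<in> \<nu> ` (S - {\<zero>})" and le: "\<And>s. \<lbrakk>s \<in> S; s \<noteq> \<zero>\<rbrakk> \<Longrightarrow> ?\<gamma> \<le> \<nu> s"
    using S(1) by (auto intro!: Min_in)
  have S_center: "S \<subseteq> center" using genideal_self[OF S(2)] S(3) by simp
  have "S \<subseteq> value_ideal ?\<gamma>" using le S(2) unfolding value_ideal_def by auto
  then have "center \<subseteq> value_ideal ?\<gamma>"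
    using genideal_minimal[OF value_ideal_is_ideal] S(3) by simp
  then have eq: "min_value R \<nu> center = ?\<gamma>"
    unfolding min_value_def using in_S S_center
    by (intro Least_equality) (auto intro: value_ideal_ge)
  have "0 < \<nu> s" if "s \<in> S" "s \<noteq> \<zero>" for s
    using that S_center unfolding valuation_ideal_def by auto
  then show "0 < min_value R \<nu> center"
    using in_S unfolding eq by fastforce
  show "min_value R \<nu> center \<le> \<nu> s" if "s \<in> S" "s \<noteq> \<zero>" for s
    using le that unfolding eq .
qed

lemma value_monomial_ge:
  assumes S: "S \<subseteq> carrier R" "\<And>s. \<lbrakk>s \<in> S; s \<noteq> \<zero>\<rbrakk> \<Longrightarrow> \<gamma> \<le> \<nu> s"
  shows "monomials S k \<subseteq> value_ideal (nat_mult k \<gamma>)"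
proof (induction k)
  case 0
  then show ?case by (simp add: value_ideal_def nat_mult_def value_one)
next
  case (Suc k)
  show ?case
  proof
    fix u assume "u \<in> monomials S (Suc k)"
    then obtain s t where st: "s \<in> S" "t \<in> monomials S k" "u = s \<otimes> t"
      by (rule monomials_SucE)
    then have t: "t \<in> carrier R" "t = \<zero> \<or> nat_mult k \<gamma> \<le> \<nu> t" and s: "s \<in> carrier R"
      using Suc S(1) unfolding value_ideal_def by auto
    have "nat_mult (Suc k) \<gamma> \<le> \<nu> u" if "u \<noteq> \<zero>"
    proof -
      have nz: "s \<noteq> \<zero>" "t \<noteq> \<zero>" using that st s t by auto
      then have "nat_mult k \<gamma> + \<gamma> \<le> \<nu> t + \<nu> s" using t S(2) st by (intro add_mono) auto
      then show ?thesis
        using value_mult[OF s t(1)] nz st by (simp add: nat_mult_def add.commute)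
    qed
    then show "u \<in> value_ideal (nat_mult (Suc k) \<gamma>)"
      using st s t unfolding value_ideal_def by auto
  qed
qed

text \<open>The value \<open>0\<close> of \<open>\<one>\<close> is lost as well, but it is not a value on the center; counting it
  together with \<open>B\<close> yields the strict inequality.\<close>

theorem card_small_values_less:
  fixes d :: nat
  assumes S: "finite S" "S \<subseteq> carrier R" "center = Idl S"
  defines "B \<equiv> {\<gamma> \<in> value_set center. \<gamma> < nat_mult (d + 1) (min_value R \<nu> center)}"
  shows "finite B \<and> card B < (card S + d) choose d"
proof (cases "center = {\<zero>}")
  case True
  \<comment> \<open>With no values on the center, \<open>min_value\<close> is unspecified, but there is nothing to count.\<close>
  then show ?thesis by (simp add: B_def value_set_def)
next
  case False
  let ?s = "min_value R \<nu> center" and ?I = "Idl (monomials S (Suc d))"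
  note s = min_value_le[OF S False]
  have "?I \<subseteq> value_ideal (nat_mult (Suc d) ?s)"
    by (rule genideal_minimal[OF value_ideal_is_ideal value_monomial_ge[OF S(2) s(2)]])
  then have ge: "nat_mult (Suc d) ?s \<le> \<gamma>" if "\<gamma> \<in> value_set ?I" for \<gamma>
    using that value_ideal_ge unfolding value_set_def by auto
  have "0 \<le> nat_mult d ?s" unfolding nat_mult_def using s(1) by (intro sum_nonneg) simp
  then have pos: "0 < nat_mult (Suc d) ?s"
    using add_pos_nonneg[OF s(1), of "nat_mult d ?s"] by (simp add: nat_mult_def add.commute)
  have "\<nu> \<one> \<in> value_set (carrier R)" unfolding value_set_def by auto
  then have zero: "0 \<in> value_set (carrier R)" by (simp add: value_one)
  have zero_notin: "0 \<notin> B"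
    unfolding B_def value_set_def valuation_ideal_def by auto
  have "value_set center \<subseteq> value_set (carrier R)"
    by (rule value_set_mono) (auto simp: valuation_ideal_def)
  then have sub: "insert 0 B \<subseteq> value_set (carrier R) - value_set ?I"
    using zero pos ge unfolding B_def by fastforce
  note bound = card_values_lost_monomials[OF S, of d]
  have fin: "finite (insert 0 B)" using finite_subset[OF sub conjunct1[OF bound]] .
  have "card (insert 0 B) \<le> (\<Sum>i\<le>d. card (monomials S i))"
    using card_mono[OF _ sub] bound by linarith
  also have "\<dots> \<le> (card S + d) choose d" by (rule card_monomials_le[OF S(1,2)])
  finally show ?thesis using fin zero_notin by simp
qed

end

section \<open>Dominated regular local rings\<close>

lemma dominated_subring_nonneg_valued_domain:
  assumes "quotient_field_of K A" "valuation K \<nu>" "dominates K \<nu> A \<mm>"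
  shows "nonneg_valued_domain (K\<lparr>carrier := A\<rparr>) \<nu>"
    and "valuation_ideal (K\<lparr>carrier := A\<rparr>) \<nu> = \<mm>"
proof -
  interpret K: field K using assms(1) unfolding quotient_field_of_def by blast
  have A: "subring A K" using assms(1) unfolding quotient_field_of_def by blast
  then have AK: "A \<subseteq> carrier K" by (rule subringE)
  have "domain (K\<lparr>carrier := A\<rparr>)"
    using A K.subring_is_domain by blast
  then interpret D: domain "K\<lparr>carrier := A\<rparr>" .
  show "nonneg_valued_domain (K\<lparr>carrier := A\<rparr>) \<nu>"
  proof
    show "valuation (K\<lparr>carrier := A\<rparr>) \<nu>"
      using assms(2) AK unfolding valuation_def by auto
    show "0 \<le> \<nu> x" if "x \<in> carrier (K\<lparr>carrier := A\<rparr>)" "x \<noteq> \<zero>\<^bsub>K\<lparr>carrier := A\<rparr>\<^esub>" for x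
      using that assms(3) unfolding dominates_def valuation_ring_def by auto
  qed
  show "valuation_ideal (K\<lparr>carrier := A\<rparr>) \<nu> = \<mm>"
    using assms(3) AK unfolding dominates_def valuation_ideal_def by auto
qed

text \<open>The least number of generators is attained, as the maximal ideal is finitely generated.\<close>

lemma regular_local_ring_generators:
  assumes "regular_local_ring R \<mm>" "krull_dim R = enat n"
  obtains S where "finite S" "card S = n" "S \<subseteq> carrier R" "\<mm> = Idl\<^bsub>R\<^esub> S"
proof -
  let ?P = "\<lambda>k. \<exists>S \<subseteq> carrier R. finite S \<and> card S = k \<and> Idl\<^bsub>R\<^esub> S = \<mm>"
  have "maximalideal \<mm> R" using assms(1) unfolding regular_local_ring_def local_ring_def by blast
  then have "ideal \<mm> R" by (rule maximalideal.axioms)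
  then have "\<exists>k. ?P k"
    using noetherian_ring.finetely_gen assms(1) unfolding regular_local_ring_def by metis
  then have "?P (min_generators R \<mm>)"
    unfolding min_generators_def by (rule LeastI_ex)
  moreover have "min_generators R \<mm> = n" using assms unfolding regular_local_ring_def by simp
  ultimately show ?thesis using that by blast
qed

theorem corollary2p2:
  fixes K :: "('a, 'b) ring_scheme"
    and A \<mm> :: "'a set"
    and \<nu> :: "'a \<Rightarrow> 'g::linordered_ab_group_add"
    and n :: nat
    and s0 :: 'g
  assumes "quotient_field_of K A"
    and "regular_local_ring (K\<lparr>carrier := A\<rparr>) \<mm>"
    and "krull_dim (K\<lparr>carrier := A\<rparr>) = enat n"
    and "equicharacteristic (K\<lparr>carrier := A\<rparr>) \<mm>"
    and "valuation K \<nu>"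
    and "rank_one K \<nu>"
    and "dominates K \<nu> A \<mm>"
  defines "s0 \<equiv> min_value K \<nu> \<mm>"
  shows "\<forall>d::nat.
     finite (\<nu> ` (\<mm> - {\<zero>\<^bsub>K\<^esub>}) \<inter> value_interval K \<nu> 0 (nat_mult (d + 1) s0)) \<and>
     card (\<nu> ` (\<mm> - {\<zero>\<^bsub>K\<^esub>}) \<inter> value_interval K \<nu> 0 (nat_mult (d + 1) s0)) < (n + d) choose n"
proof
  fix d :: nat
  note \<mm> = dominated_subring_nonneg_valued_domain(2)[OF assms(1,5,7)]
  interpret V: nonneg_valued_domain "K\<lparr>carrier := A\<rparr>" \<nu>
    by (rule dominated_subring_nonneg_valued_domain(1)[OF assms(1,5,7)])
  obtain S where S: "finite S" "card S = n" "S \<subseteq> carrier (K\<lparr>carrier := A\<rparr>)"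
    "\<mm> = Idl\<^bsub>K\<lparr>carrier := A\<rparr>\<^esub> S"
    using regular_local_ring_generators[OF assms(2,3)] .
  let ?X = "{\<gamma> \<in> V.value_set \<mm>. \<gamma> < nat_mult (d + 1) s0}"
  let ?Y = "\<nu> ` (\<mm> - {\<zero>\<^bsub>K\<^esub>}) \<inter> value_interval K \<nu> 0 (nat_mult (d + 1) s0)"
  have sub: "?Y \<subseteq> ?X"
    unfolding V.value_set_def value_interval_def by auto
  have "min_value (K\<lparr>carrier := A\<rparr>) \<nu> \<mm> = s0"
    unfolding s0_def min_value_def by simp
  then have X: "finite ?X" "card ?X < (n + d) choose d"
    using V.card_small_values_less[of S d] S unfolding \<mm> by auto
  then have "finite ?Y" using sub finite_subset by blast
  moreover have "card ?Y < (n + d) choose d"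
    using card_mono[OF X(1) sub] X(2) by linarith
  moreover have "(n + d) choose d = (n + d) choose n"
    using binomial_symmetric[of d "n + d"] by simp
  ultimately show "finite ?Y \<and> card ?Y < (n + d) choose n" by simp
qed

end
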